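(* Let $n\ge 1$ and let $\|\cdot\|$ be an arbitrary norm on $\mathbb{R}^n$. There is a constant $C>0$, depending only on $\|\cdot\|$ and on the space dimension $n$, such that for every $r\in\mathbb{N}$, $r\ge 1$, and all points $A_1,\ldots,A_r\in\mathbb{R}^n$ for which the vector $(A_1,\ldots,A_r)$ is self-contracted with respect to the norm $\|\cdot\|$, one has \[ \ell(A_1,\ldots,A_r)\le C\,|A_1A_r|. \]
   Context: $|\cdot|$ is the Euclidean norm on $\mathbb{R}^n$ and $|AB|:=|A-B|$. The vector $(A_1,\ldots,A_r)$ of points of $\mathbb{R}^n$ is called self-contracted with respect to the norm $\|\cdot\|$ if $\|A_k-A_j\|\le\|A_k-A_i\|$ whenever $1\le i\le j\le k\le r$. The variation is the Euclidean length of the polygonal line: $\ell(A_1,\ldots,A_r):=\sum_{i=1}^{r-1}|A_iA_{i+1}|$. *)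

theory Defs
  imports "HOL-Analysis.Analysis"
begin

text \<open>
  The class operation \<open>norm\<close> on \<open>real ^ 'n\<close> is the Euclidean norm. An arbitrary further norm is a
  function satisfying the following predicate.
\<close>

definition is_norm :: "('a::real_vector \<Rightarrow> real) \<Rightarrow> bool" where
  "is_norm N \<longleftrightarrow>
     (\<forall>x. 0 \<le> N x) \<and>
     (\<forall>x. N x = 0 \<longleftrightarrow> x = 0) \<and>
     (\<forall>c x. N (c *\<^sub>R x) = \<bar>c\<bar> * N x) \<and>
     (\<forall>x y. N (x + y) \<le> N x + N y)"

text \<open>
  A vector \<open>(A\<^sub>1, \<dots>, A\<^sub>r)\<close> of points is a length \<open>r\<close> together with a function \<open>A\<close> on \<open>nat\<close>, of which
  only the values at \<open>1, \<dots>, r\<close> are used.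
\<close>

definition self_contracted ::
    "('a::real_vector \<Rightarrow> real) \<Rightarrow> nat \<Rightarrow> (nat \<Rightarrow> 'a) \<Rightarrow> bool" where
  "self_contracted N r A \<longleftrightarrow>
     (\<forall>i j k. 1 \<le> i \<and> i \<le> j \<and> j \<le> k \<and> k \<le> r \<longrightarrow> N (A k - A j) \<le> N (A k - A i))"

definition variation :: "nat \<Rightarrow> (nat \<Rightarrow> real ^ 'n) \<Rightarrow> real" where
  "variation r A = (\<Sum>i\<in>{1..<r}. norm (A i - A (i + 1)))"

end

theory Submission
  imports Defs
begin

text \<open>
  Seen from a point \<open>A k\<close>, the later points \<open>p i = A i - A k\<close> satisfy \<open>N (p j - p i) \<le> N (p j)\<close> for
  \<open>i < j\<close>. In a nonnegative combination of the \<open>p i\<close> the latest term therefore cannot be cancelled by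
  the earlier ones, so, by induction and Caratheodory's theorem, the convex hull of the normalized
  \<open>p i\<close> stays at a distance from \<open>0\<close> that depends only on the dimension and on \<open>N\<close>. Hence there is a
  vector \<open>w\<close>, which may be taken from a fixed finite net \<open>W\<close> of the unit sphere, with
  \<open>w \<bullet> p i \<ge> c * N (p i)\<close> for all \<open>i > k\<close>. Each of the nondecreasing quantities
  \<open>min {w \<bullet> A j | j \<ge> k}\<close>, \<open>w \<in> W\<close>, varies in total by at most a multiple of the distance between
  the endpoints, and the step from \<open>A k\<close> to \<open>A (k + 1)\<close> raises at least one of them by an amount
  proportional to the length of the step.
\<close>

section \<open>Comparison of an arbitrary norm with the Euclidean norm\<close>

lemma is_norm_ge_0: "is_norm N \<Longrightarrow> 0 \<le> N x"
  and is_norm_eq_0: "is_norm N \<Longrightarrow> N x = 0 \<longleftrightarrow> x = 0"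
  and is_norm_scale: "is_norm N \<Longrightarrow> N (c *\<^sub>R x) = \<bar>c\<bar> * N x"
  and is_norm_triangle: "is_norm N \<Longrightarrow> N (x + y) \<le> N x + N y"
  unfolding is_norm_def by blast+

lemma is_norm_minus: "is_norm N \<Longrightarrow> N (- x) = N x"
  using is_norm_scale[of N "-1" x] by simp

lemma is_norm_minus_commute: "is_norm N \<Longrightarrow> N (x - y) = N (y - x)"
  using is_norm_minus[of N "x - y"] by simp

lemma is_norm_diff_triangle: "is_norm N \<Longrightarrow> N (x - z) \<le> N (x - y) + N (y - z)"
  using is_norm_triangle[of N "x - y" "y - z"] by simp

lemma is_norm_sum:
  assumes "is_norm N"
  shows "N (\<Sum>i\<in>I. f i) \<le> (\<Sum>i\<in>I. N (f i))"
proof (induction I rule: infinite_finite_induct)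
  case (insert i I)
  then show ?case using is_norm_triangle[OF assms, of "f i" "\<Sum>i\<in>I. f i"] by simp
qed (use is_norm_eq_0[OF assms, of 0] in auto)

lemma is_norm_upper:
  fixes N :: "'a::euclidean_space \<Rightarrow> real"
  assumes "is_norm N"
  obtains \<beta> where "\<beta> > 0" "\<And>x. N x \<le> \<beta> * norm x"
proof
  let ?\<beta> = "(\<Sum>b\<in>Basis. N b) + 1"
  have nonneg: "(\<Sum>b\<in>Basis. N b) \<ge> 0"
    by (intro sum_nonneg is_norm_ge_0 assms)
  then show "?\<beta> > 0" by simp
  fix x
  have "N x = N (\<Sum>b\<in>Basis. (x \<bullet> b) *\<^sub>R b)" by (simp add: euclidean_representation)
  also have "\<dots> \<le> (\<Sum>b\<in>Basis. \<bar>x \<bullet> b\<bar> * N b)"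
    using is_norm_sum[OF assms, of "\<lambda>b. (x \<bullet> b) *\<^sub>R b" Basis] by (simp add: is_norm_scale[OF assms])
  also have "\<dots> \<le> (\<Sum>b\<in>Basis. norm x * N b)"
    by (intro sum_mono mult_right_mono Basis_le_norm is_norm_ge_0 assms)
  also have "\<dots> \<le> ?\<beta> * norm x"
    by (simp add: sum_distrib_left algebra_simps)
  finally show "N x \<le> ?\<beta> * norm x" .
qed

text \<open>The upper bound makes \<open>N\<close> Lipschitz, hence continuous, so it attains a
  minimum on the compact unit sphere. That minimum is positive and serves as
  \<open>\<alpha>\<close>; scaling does the rest.\<close>

lemma is_norm_lower:
  fixes N :: "'a::euclidean_space \<Rightarrow> real"
  assumes N: "is_norm N"
  obtains \<alpha> where "\<alpha> > 0" "\<And>x. \<alpha> * norm x \<le> N x"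
proof -
  obtain \<beta> where \<beta>: "\<beta> > 0" "\<And>x. N x \<le> \<beta> * norm x" using is_norm_upper[OF N] by blast
  have "\<bar>N x - N y\<bar> \<le> \<beta> * dist x y" for x y
    using is_norm_diff_triangle[OF N, of x 0 y] is_norm_diff_triangle[OF N, of y 0 x]
      is_norm_minus_commute[OF N, of x y] \<beta>(2)[of "x - y"] by (simp add: dist_norm)
  then have "\<beta>-lipschitz_on UNIV N"
    using \<beta>(1) by (intro lipschitz_onI) (auto simp: dist_real_def)
  then have "continuous_on UNIV N" by (rule lipschitz_on_continuous_on)
  then have cont: "continuous_on (sphere 0 1) N" by (rule continuous_on_subset) simp
  have "\<exists>x\<in>sphere (0::'a) 1. \<forall>y\<in>sphere 0 1. N x \<le> N y"
    by (intro continuous_attains_inf cont) auto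
  then obtain u where u: "norm u = 1" "\<And>y. norm y = 1 \<Longrightarrow> N u \<le> N y" by auto
  show thesis
  proof
    show "N u > 0" using u(1) is_norm_ge_0[OF N, of u] is_norm_eq_0[OF N, of u] by fastforce
    fix x
    show "N u * norm x \<le> N x"
    proof (cases "x = 0")
      case False
      have "N u \<le> N ((1 / norm x) *\<^sub>R x)" using False by (intro u(2)) simp
      then show ?thesis using False by (simp add: is_norm_scale[OF N] field_simps)
    qed (simp add: is_norm_ge_0[OF N])
  qed
qed

section \<open>Lower bounds for nonnegative combinations\<close>

lemma latest_coefficient_le:
  assumes N: "is_norm N" and a: "\<And>i. i \<in> I \<Longrightarrow> a i \<ge> 0" and "b \<ge> 0"
    and le: "\<And>i. i \<in> I \<Longrightarrow> N (q - p i) \<le> N q"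
  shows "b * N q \<le> N ((\<Sum>i\<in>I. a i *\<^sub>R p i) + b *\<^sub>R q)"
proof -
  define s where "s = (\<Sum>i\<in>I. a i)"
  define x where "x = (\<Sum>i\<in>I. a i *\<^sub>R p i) + b *\<^sub>R q"
  have "s \<ge> 0" unfolding s_def by (intro sum_nonneg a)
  \<comment> \<open>Each difference \<open>q - p i\<close> has norm at most \<open>N q\<close>, so
    the triangle inequality will bound \<open>(s + b) * N q\<close> by \<open>s * N q + N x\<close>,
    where \<open>s * N q\<close> cancels.\<close>
  have eq: "(s + b) *\<^sub>R q = (\<Sum>i\<in>I. a i *\<^sub>R (q - p i)) + x"
    unfolding s_def x_def by (simp add: scaleR_diff_right sum_subtractf scaleR_left_distrib scaleR_left.sum)
  have "(s + b) * N q = N ((s + b) *\<^sub>R q)"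
    using \<open>s \<ge> 0\<close> \<open>b \<ge> 0\<close> by (simp add: is_norm_scale[OF N])
  also have "\<dots> \<le> N (\<Sum>i\<in>I. a i *\<^sub>R (q - p i)) + N x"
    unfolding eq by (rule is_norm_triangle[OF N])
  also have "N (\<Sum>i\<in>I. a i *\<^sub>R (q - p i)) \<le> (\<Sum>i\<in>I. a i * N (q - p i))"
    using is_norm_sum[OF N, of "\<lambda>i. a i *\<^sub>R (q - p i)" I] a by (simp add: is_norm_scale[OF N])
  also have "\<dots> \<le> (\<Sum>i\<in>I. a i * N q)"
    by (intro sum_mono mult_left_mono le a)
  also have "\<dots> = s * N q" by (simp add: s_def sum_distrib_right)
  finally show ?thesis by (simp add: x_def algebra_simps)
qed

text \<open>Induction on the largest index: the latest term is at most the norm of the whole sum, so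
  removing it at most doubles that norm. The constants thus obey
  \<open>f (n + 1) = 2 * f n + 1\<close> with \<open>f 0 = 0\<close>, whence
  \<open>2 ^ n - 1\<close>.\<close>

lemma sum_norm_le_norm_sum:
  fixes p :: "nat \<Rightarrow> 'a::real_vector"
  assumes N: "is_norm N" and "finite I" and a: "\<And>i. i \<in> I \<Longrightarrow> a i \<ge> 0"
    and le: "\<And>i j. i \<in> I \<Longrightarrow> j \<in> I \<Longrightarrow> i < j \<Longrightarrow> N (p j - p i) \<le> N (p j)"
  shows "(\<Sum>i\<in>I. a i * N (p i)) \<le> (2 ^ card I - 1) * N (\<Sum>i\<in>I. a i *\<^sub>R p i)"
  using assms(2-)
proof (induction I rule: finite_linorder_max_induct)
  case (insert m I)
  let ?y = "\<Sum>i\<in>I. a i *\<^sub>R p i"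
  let ?x = "?y + a m *\<^sub>R p m"
  have m: "m \<notin> I" using insert.hyps by auto
  have latest: "a m * N (p m) \<le> N ?x"
    using insert.hyps insert.prems by (intro latest_coefficient_le N) auto
  have "N ?y \<le> N ?x + a m * N (p m)"
    using is_norm_triangle[OF N, of ?x "- (a m *\<^sub>R p m)"] insert.prems(1)[of m]
    by (simp add: is_norm_minus[OF N] is_norm_scale[OF N])
  then have y: "N ?y \<le> 2 * N ?x" using latest by simp
  have "(\<Sum>i\<in>I. a i * N (p i)) \<le> (2 ^ card I - 1) * N ?y"
    using insert.prems by (intro insert.IH) auto
  also have "\<dots> \<le> (2 ^ card I - 1) * (2 * N ?x)"
    by (intro mult_left_mono y) simp
  finally show ?case
    using latest m insert.hyps(1) by (simp add: algebra_simps add.commute)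
qed simp

text \<open>Caratheodory's theorem leaves at most \<open>DIM('a) + 1\<close> points in the
  combination, so the exponential factor does not grow with \<open>I\<close>.\<close>

lemma norm_convex_hull_ge:
  fixes p :: "nat \<Rightarrow> 'a::euclidean_space"
  assumes N: "is_norm N"
    and nz: "\<And>i. i \<in> I \<Longrightarrow> p i \<noteq> 0"
    and le: "\<And>i j. i \<in> I \<Longrightarrow> j \<in> I \<Longrightarrow> i < j \<Longrightarrow> N (p j - p i) \<le> N (p j)"
    and x: "x \<in> convex hull ((\<lambda>i. (1 / N (p i)) *\<^sub>R p i) ` I)"
  shows "1 \<le> 2 ^ (DIM('a) + 1) * N x"
proof -
  let ?q = "\<lambda>i. (1 / N (p i)) *\<^sub>R p i"
  from x obtain S where S: "finite S" "S \<subseteq> ?q ` I" "card S \<le> DIM('a) + 1" "x \<in> convex hull S"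
    unfolding caratheodory[of "?q ` I"] by blast
  \<comment> \<open>Different indices may give the same normalized point; \<open>J\<close> picks one
    index for each point of \<open>S\<close>.\<close>
  obtain J where J: "J \<subseteq> I" "inj_on ?q J" "S = ?q ` J"
    using S(2) by (auto simp: subset_image_inj)
  have "finite J" and card: "card J \<le> DIM('a) + 1"
    using S J by (auto simp: finite_image_iff card_image)
  obtain u where u: "\<And>y. y \<in> S \<Longrightarrow> 0 \<le> u y" "sum u S = 1" "(\<Sum>y\<in>S. u y *\<^sub>R y) = x"
    using S(4) unfolding convex_hull_finite[OF S(1)] by auto
  \<comment> \<open>The division absorbs the normalization: the terms \<open>a i * N (p i)\<close>
    are the convex weights and sum to 1.\<close>
  define a where "a i = u (?q i) / N (p i)" for i
  have pos: "N (p i) > 0" if "i \<in> J" for i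
    using nz[of i] J(1) that is_norm_ge_0[OF N, of "p i"] is_norm_eq_0[OF N, of "p i"] by fastforce
  have "1 = (\<Sum>i\<in>J. u (?q i))" using u(2) J by (simp add: sum.reindex)
  also have "\<dots> = (\<Sum>i\<in>J. a i * N (p i))"
    using pos by (intro sum.cong) (auto simp: a_def less_le)
  also have "\<dots> \<le> (2 ^ card J - 1) * N (\<Sum>i\<in>J. a i *\<^sub>R p i)"
  proof (rule sum_norm_le_norm_sum[OF N \<open>finite J\<close>])
    show "a i \<ge> 0" if "i \<in> J" for i
      using that u(1)[of "?q i"] pos[OF that] J(3) by (auto simp: a_def)
    show "N (p j - p i) \<le> N (p j)" if "i \<in> J" "j \<in> J" "i < j" for i j
      using le that J(1) by blast
  qed
  also have "(\<Sum>i\<in>J. a i *\<^sub>R p i) = x" using u(3) J by (simp add: sum.reindex a_def)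
  also have "(2 ^ card J - 1) * N x \<le> 2 ^ (DIM('a) + 1) * N x"
  proof (intro mult_right_mono is_norm_ge_0[OF N])
    show "2 ^ card J - 1 \<le> (2::real) ^ (DIM('a) + 1)"
      using power_increasing[OF card, of "2::real"] by simp
  qed
  finally show ?thesis .
qed

section \<open>Directions in which all later points lie ahead\<close>

lemma forward_direction:
  fixes N :: "'a::euclidean_space \<Rightarrow> real"
  assumes N: "is_norm N"
  obtains c where "c > 0"
    "\<And>(p :: nat \<Rightarrow> 'a) I. \<lbrakk>finite I; I \<noteq> {}; \<And>i. i \<in> I \<Longrightarrow> p i \<noteq> 0;
       \<And>i j. i \<in> I \<Longrightarrow> j \<in> I \<Longrightarrow> i < j \<Longrightarrow> N (p j - p i) \<le> N (p j)\<rbrakk>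
       \<Longrightarrow> \<exists>w. norm w = 1 \<and> (\<forall>i\<in>I. c * N (p i) \<le> w \<bullet> p i)"
proof -
  obtain \<beta> where \<beta>: "\<beta> > 0" "\<And>x. N x \<le> \<beta> * norm x" using is_norm_upper[OF N] by blast
  define D where "D = (2::real) ^ (DIM('a) + 1)"
  have D: "D > 0" by (simp add: D_def)
  show thesis
  proof
    show "1 / (D * \<beta>) > 0" using D \<beta> by simp
    fix p :: "nat \<Rightarrow> 'a" and I
    assume I: "finite I" "I \<noteq> {}" and nz: "\<And>i. i \<in> I \<Longrightarrow> p i \<noteq> 0"
      and le: "\<And>i j. i \<in> I \<Longrightarrow> j \<in> I \<Longrightarrow> i < j \<Longrightarrow> N (p j - p i) \<le> N (p j)"
    let ?q = "\<lambda>i. (1 / N (p i)) *\<^sub>R p i"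
    let ?H = "convex hull (?q ` I)"
    have H: "closed ?H" "convex ?H" "?H \<noteq> {}"
      using I by (auto intro: compact_imp_closed compact_convex_hull finite_imp_compact)
    \<comment> \<open>The direction is that of the point of the hull closest to 0: every point of
      the hull has inner product at least \<open>norm z ^ 2\<close> with it, and
      \<open>norm z\<close> is bounded below by the preceding estimate.\<close>
    define z where "z = closest_point ?H 0"
    have "z \<in> ?H" unfolding z_def by (intro closest_point_in_set H)
    then have "1 \<le> D * N z"
      unfolding D_def by (intro norm_convex_hull_ge[OF N nz le]) auto
    also have "\<dots> \<le> D * (\<beta> * norm z)" using D \<beta>(2) by (intro mult_left_mono) auto
    finally have z: "1 / (D * \<beta>) \<le> norm z" using D \<beta>(1) by (simp add: field_simps)
    have "z \<noteq> 0" using z D \<beta>(1) by (auto simp: field_simps)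
    show "\<exists>w. norm w = 1 \<and> (\<forall>i\<in>I. 1 / (D * \<beta>) * N (p i) \<le> w \<bullet> p i)"
    proof (intro exI conjI ballI)
      show "norm ((1 / norm z) *\<^sub>R z) = 1" using \<open>z \<noteq> 0\<close> by simp
      fix i assume i: "i \<in> I"
      then have pos: "N (p i) > 0"
        using nz[of i] is_norm_ge_0[OF N, of "p i"] is_norm_eq_0[OF N, of "p i"] by fastforce
      have "?q i \<in> ?H" using i by (intro hull_inc) auto
      then have "(0 - z) \<bullet> (?q i - z) \<le> 0"
        unfolding z_def by (intro closest_point_dot H)
      then have "norm z * norm z \<le> z \<bullet> ?q i"
        by (simp add: inner_diff_right power2_norm_eq_inner[symmetric] power2_eq_square)
      then have "norm z * N (p i) \<le> ((1 / norm z) *\<^sub>R z) \<bullet> p i"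
        using \<open>z \<noteq> 0\<close> pos by (simp add: field_simps)
      then show "1 / (D * \<beta>) * N (p i) \<le> ((1 / norm z) *\<^sub>R z) \<bullet> p i"
        using mult_right_mono[OF z, of "N (p i)"] pos by linarith
    qed
  qed
qed

text \<open>Compactness of the sphere replaces a direction depending on the points by one from a
  finite set fixed in advance, so that the increments can later be summed over all
  directions.\<close>

lemma forward_direction_net:
  fixes N :: "'a::euclidean_space \<Rightarrow> real"
  assumes N: "is_norm N"
  obtains c W where "c > 0" "finite W" "W \<subseteq> sphere 0 1"
    "\<And>(p :: nat \<Rightarrow> 'a) I. \<lbrakk>finite I; I \<noteq> {}; \<And>i. i \<in> I \<Longrightarrow> p i \<noteq> 0;
       \<And>i j. i \<in> I \<Longrightarrow> j \<in> I \<Longrightarrow> i < j \<Longrightarrow> N (p j - p i) \<le> N (p j)\<rbrakk>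
       \<Longrightarrow> \<exists>w\<in>W. \<forall>i\<in>I. c * N (p i) \<le> w \<bullet> p i"
proof -
  obtain c where c: "c > 0" and dir: "\<And>(p :: nat \<Rightarrow> 'a) I. \<lbrakk>finite I; I \<noteq> {}; \<And>i. i \<in> I \<Longrightarrow> p i \<noteq> 0;
       \<And>i j. i \<in> I \<Longrightarrow> j \<in> I \<Longrightarrow> i < j \<Longrightarrow> N (p j - p i) \<le> N (p j)\<rbrakk>
       \<Longrightarrow> \<exists>w. norm w = 1 \<and> (\<forall>i\<in>I. c * N (p i) \<le> w \<bullet> p i)"
    using forward_direction[OF N] by metis
  obtain \<alpha> where \<alpha>: "\<alpha> > 0" "\<And>x. \<alpha> * norm x \<le> N x" using is_norm_lower[OF N] by blast
  \<comment> \<open>With this radius, replacing \<open>v\<close> by a net point changes the inner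
    product with \<open>p i\<close> by at most \<open>c / 2 * N (p i)\<close>, which costs half of
    the constant.\<close>
  have "sphere (0::'a) 1 \<subseteq> (\<Union>w\<in>sphere 0 1. ball w (c * \<alpha> / 2))"
  proof
    fix v :: 'a assume "v \<in> sphere 0 1"
    then show "v \<in> (\<Union>w\<in>sphere 0 1. ball w (c * \<alpha> / 2))"
      using c \<alpha>(1) by (intro UN_I[of v]) auto
  qed
  then obtain W where W: "W \<subseteq> sphere (0::'a) 1" "finite W"
    "sphere 0 1 \<subseteq> (\<Union>w\<in>W. ball w (c * \<alpha> / 2))"
    using compactE_image[of "sphere (0::'a) 1" "sphere 0 1" "\<lambda>w. ball w (c * \<alpha> / 2)"]
    by (metis compact_sphere open_ball)
  show thesis
  proof
    show "c / 2 > 0" "finite W" "W \<subseteq> sphere 0 1" using c W by auto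
    fix p :: "nat \<Rightarrow> 'a" and I
    assume I: "finite I" "I \<noteq> {}" "\<And>i. i \<in> I \<Longrightarrow> p i \<noteq> 0"
      "\<And>i j. i \<in> I \<Longrightarrow> j \<in> I \<Longrightarrow> i < j \<Longrightarrow> N (p j - p i) \<le> N (p j)"
    from dir[of I p, OF I] obtain v where v: "norm v = 1" "\<And>i. i \<in> I \<Longrightarrow> c * N (p i) \<le> v \<bullet> p i"
      by blast
    then obtain w where w: "w \<in> W" "dist w v < c * \<alpha> / 2"
      using W(3) by (auto simp: subset_iff)
    show "\<exists>w\<in>W. \<forall>i\<in>I. c / 2 * N (p i) \<le> w \<bullet> p i"
    proof (intro bexI[of _ w] ballI w(1))
      fix i assume i: "i \<in> I"
      have "v \<bullet> p i - w \<bullet> p i \<le> norm (v - w) * norm (p i)"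
        using norm_cauchy_schwarz[of "v - w" "p i"] by (simp add: inner_diff_left)
      also have "\<dots> \<le> c * \<alpha> / 2 * norm (p i)"
        using w(2) by (intro mult_right_mono) (auto simp: dist_norm norm_minus_commute)
      also have "\<dots> \<le> c / 2 * N (p i)"
        using mult_left_mono[OF \<alpha>(2)[of "p i"], of "c / 2"] c by (simp add: algebra_simps)
      finally show "c / 2 * N (p i) \<le> w \<bullet> p i" using v(2)[OF i] by simp
    qed
  qed
qed

section \<open>Summing the increments of the tail minima\<close>

lemma self_contractedD:
  "self_contracted N r A \<Longrightarrow> 1 \<le> i \<Longrightarrow> i \<le> j \<Longrightarrow> j \<le> k \<Longrightarrow> k \<le> r \<Longrightarrow> N (A k - A j) \<le> N (A k - A i)"
  unfolding self_contracted_def by blast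

text \<open>The triangle inequality goes through \<open>A j\<close>, which is no farther from
  \<open>A (k + 1)\<close> than from \<open>A k\<close>. This turns a gain proportional to
  \<open>N (A j - A k)\<close> into one proportional to the step, uniformly in
  \<open>j\<close>.\<close>

lemma self_contracted_step_le:
  assumes N: "is_norm N" and "self_contracted N r A" "1 \<le> k" "k < j" "j \<le> r"
  shows "N (A (k + 1) - A k) \<le> 2 * N (A j - A k)"
proof -
  have "N (A j - A (k + 1)) \<le> N (A j - A k)"
    using assms by (intro self_contractedD) auto
  then show ?thesis
    using is_norm_diff_triangle[OF N, of "A (k + 1)" "A k" "A j"]
      is_norm_minus_commute[OF N, of "A j" "A (k + 1)"] by simp
qed

lemma self_contracted_length_bound:
  fixes N :: "'a::euclidean_space \<Rightarrow> real"
  assumes N: "is_norm N"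
  obtains K where "K > 0" "\<And>r (A :: nat \<Rightarrow> 'a). \<lbrakk>r \<ge> 1; self_contracted N r A\<rbrakk>
    \<Longrightarrow> (\<Sum>k\<in>{1..<r}. N (A (k + 1) - A k)) \<le> K * N (A r - A 1)"
proof -
  obtain c W where c: "c > 0" and W: "finite W" "W \<subseteq> sphere (0::'a) 1"
    and dir: "\<And>(p :: nat \<Rightarrow> 'a) I. \<lbrakk>finite I; I \<noteq> {}; \<And>i. i \<in> I \<Longrightarrow> p i \<noteq> 0;
       \<And>i j. i \<in> I \<Longrightarrow> j \<in> I \<Longrightarrow> i < j \<Longrightarrow> N (p j - p i) \<le> N (p j)\<rbrakk>
       \<Longrightarrow> \<exists>w\<in>W. \<forall>i\<in>I. c * N (p i) \<le> w \<bullet> p i"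
    using forward_direction_net[OF N] by metis
  obtain \<alpha> where \<alpha>: "\<alpha> > 0" "\<And>x. \<alpha> * norm x \<le> N x" using is_norm_lower[OF N] by blast
  have bound: "(\<Sum>k\<in>{1..<r}. N (A (k + 1) - A k)) \<le> (2 / c * real (card W) / \<alpha>) * N (A r - A 1)"
    if r: "r \<ge> 1" and sc: "self_contracted N r A" for r :: nat and A :: "nat \<Rightarrow> 'a"
  proof -
    \<comment> \<open>Unlike \<open>w \<bullet> A k\<close>, the minimum over the tail is monotone
      in \<open>k\<close> for every \<open>w\<close>, so the directions not chosen at a given step
      do no harm.\<close>
    define m where "m w k = Min ((\<lambda>j. w \<bullet> A j) ` {k..r})" for w k
    have m_mono: "m w k \<le> m w (k + 1)" if "k < r" for w k
      unfolding m_def using that by (intro Min_antimono) auto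
    have step: "c / 2 * N (A (k + 1) - A k) \<le> (\<Sum>w\<in>W. m w (k + 1) - m w k)" if k: "k \<in> {1..<r}" for k
    proof (cases "A (k + 1) = A k")
      case True
      then show ?thesis using k is_norm_eq_0[OF N, of 0] m_mono[of k] by (auto intro!: sum_nonneg)
    next
      case False
      let ?I = "{k<..r}"
      let ?s = "N (A (k + 1) - A k)"
      have "?s > 0"
        using False is_norm_ge_0[OF N, of "A (k + 1) - A k"] is_norm_eq_0[OF N, of "A (k + 1) - A k"]
        by fastforce
      have s: "?s \<le> 2 * N (A j - A k)" if "j \<in> ?I" for j
        using that k by (intro self_contracted_step_le[OF N sc]) auto
      have "\<exists>w\<in>W. \<forall>j\<in>?I. c * N (A j - A k) \<le> w \<bullet> (A j - A k)"
      proof (rule dir)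
        \<comment> \<open>A later return to \<open>A k\<close> would force the step at
          \<open>k\<close> to have length 0.\<close>
        show "A j - A k \<noteq> 0" if "j \<in> ?I" for j
          using s[OF that] \<open>?s > 0\<close> is_norm_eq_0[OF N, of 0] by fastforce
        show "N (A j - A k - (A i - A k)) \<le> N (A j - A k)" if "i \<in> ?I" "j \<in> ?I" "i < j" for i j
          using self_contractedD[OF sc, of k i j] that k by simp
      qed (use k in auto)
      then obtain w where w: "w \<in> W" "\<And>j. j \<in> ?I \<Longrightarrow> c * N (A j - A k) \<le> w \<bullet> (A j - A k)"
        by blast
      have "w \<bullet> A k + c / 2 * ?s \<le> w \<bullet> A j" if "j \<in> ?I" for j
        using w(2)[OF that] mult_left_mono[OF s[OF that] less_imp_le[OF c]]
        unfolding inner_diff_right by simp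
      then have "w \<bullet> A k + c / 2 * ?s \<le> m w (k + 1)"
        unfolding m_def using k by (subst Min_ge_iff) auto
      moreover have "m w k \<le> w \<bullet> A k" unfolding m_def using k by (intro Min_le) auto
      ultimately have "c / 2 * ?s \<le> m w (k + 1) - m w k" by simp
      also have "\<dots> \<le> (\<Sum>w\<in>W. m w (k + 1) - m w k)"
        using m_mono k by (intro member_le_sum W(1) w(1)) auto
      finally show ?thesis .
    qed
    \<comment> \<open>At \<open>r\<close> the tail is the single point \<open>A r\<close>. The
      minimum at 1 is attained at some \<open>A j\<close>, and self-contractedness puts
      \<open>A j\<close> no farther from \<open>A r\<close> than \<open>A 1\<close> is.\<close>
    have range: "m w r - m w 1 \<le> N (A r - A 1) / \<alpha>" if "w \<in> W" for w
    proof -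
      have "m w 1 \<in> (\<lambda>j. w \<bullet> A j) ` {1..r}" unfolding m_def using r by (intro Min_in) auto
      then obtain j where j: "1 \<le> j" "j \<le> r" "m w 1 = w \<bullet> A j" by auto
      have "m w r - m w 1 = w \<bullet> (A r - A j)" using j by (simp add: m_def inner_diff_right)
      also have "\<dots> \<le> norm (A r - A j)"
        using norm_cauchy_schwarz[of w "A r - A j"] W(2) that by auto
      also have "\<dots> \<le> N (A r - A j) / \<alpha>" using \<alpha> by (simp add: field_simps)
      also have "\<dots> \<le> N (A r - A 1) / \<alpha>"
        using \<alpha>(1) j by (intro divide_right_mono self_contractedD[OF sc]) auto
      finally show ?thesis .
    qed
    have "c / 2 * (\<Sum>k\<in>{1..<r}. N (A (k + 1) - A k)) \<le> (\<Sum>k\<in>{1..<r}. \<Sum>w\<in>W. m w (k + 1) - m w k)"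
      unfolding sum_distrib_left by (intro sum_mono step)
    also have "\<dots> = (\<Sum>w\<in>W. \<Sum>k\<in>{1..<r}. m w (Suc k) - m w k)"
      by (subst sum.swap) simp
    also have "\<dots> = (\<Sum>w\<in>W. m w r - m w 1)"
      using r by (simp add: sum_Suc_diff')
    also have "\<dots> \<le> real (card W) * (N (A r - A 1) / \<alpha>)"
      by (intro sum_bounded_above range)
    finally show ?thesis using c \<alpha>(1) by (simp add: field_simps)
  qed
  show thesis
  proof
    \<comment> \<open>The summand 1 ensures positivity without an argument that \<open>W\<close> is
      nonempty.\<close>
    show "2 / c * real (card W) / \<alpha> + 1 > 0" using c \<alpha>(1) by (auto intro!: add_nonneg_pos)
    fix r and A :: "nat \<Rightarrow> 'a"
    assume "r \<ge> 1" "self_contracted N r A"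
    from bound[OF this] show "(\<Sum>k\<in>{1..<r}. N (A (k + 1) - A k)) \<le> (2 / c * real (card W) / \<alpha> + 1) * N (A r - A 1)"
      using is_norm_ge_0[OF N, of "A r - A 1"] by (simp add: distrib_right)
  qed
qed

theorem theorem3p1:
  fixes N :: "real ^ 'n \<Rightarrow> real"
  assumes "is_norm N"
  shows "\<exists>C>0. \<forall>(r::nat) (A :: nat \<Rightarrow> real ^ 'n).
           r \<ge> 1 \<longrightarrow> self_contracted N r A \<longrightarrow> variation r A \<le> C * norm (A 1 - A r)"
proof -
  obtain \<alpha> where \<alpha>: "\<alpha> > 0" "\<And>x. \<alpha> * norm x \<le> N x" using is_norm_lower[OF assms] by blast
  obtain \<beta> where \<beta>: "\<beta> > 0" "\<And>x. N x \<le> \<beta> * norm x" using is_norm_upper[OF assms] by blast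
  obtain K where K: "K > 0" "\<And>r A. \<lbrakk>r \<ge> 1; self_contracted N r A\<rbrakk>
    \<Longrightarrow> (\<Sum>k\<in>{1..<r}. N (A (k + 1) - A k)) \<le> K * N (A r - A 1)"
    using self_contracted_length_bound[OF assms] by metis
  show ?thesis
  \<comment> \<open>\<open>\<alpha>\<close> converts the length of the steps and
    \<open>\<beta>\<close> the distance of the endpoints between \<open>N\<close> and the Euclidean
    norm.\<close>
  proof (intro exI[of _ "K * \<beta> / \<alpha>"] conjI allI impI)
    show "K * \<beta> / \<alpha> > 0" using K(1) \<alpha>(1) \<beta>(1) by simp
    fix r :: nat and A :: "nat \<Rightarrow> real ^ 'n"
    assume *: "r \<ge> 1" "self_contracted N r A"
    have "\<alpha> * variation r A = (\<Sum>k\<in>{1..<r}. \<alpha> * norm (A (k + 1) - A k))"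
      by (simp add: variation_def sum_distrib_left norm_minus_commute)
    also have "\<dots> \<le> (\<Sum>k\<in>{1..<r}. N (A (k + 1) - A k))" by (intro sum_mono \<alpha>(2))
    also have "\<dots> \<le> K * N (A r - A 1)" by (rule K(2)[OF *])
    also have "\<dots> \<le> K * (\<beta> * norm (A 1 - A r))"
      using K(1) \<beta>(2)[of "A r - A 1"] by (simp add: norm_minus_commute)
    finally show "variation r A \<le> K * \<beta> / \<alpha> * norm (A 1 - A r)"
      using \<alpha>(1) by (simp add: field_simps)
  qed
qed

end
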